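(* Let $\mathcal A=\{a,b\}\subseteq\mathbb R$ be a binary alphabet and let $(\mathbb X,S)\subseteq\mathcal A^{\mathbb Z}$ be a simple Toeplitz subshift. Let $f_1:\mathbb X\to\mathbb R$ be locally constant with window size $1$, i.e. $f_1(x)=g(x_n)$ for some fixed $n\in\mathbb Z$ and $g:\mathcal A\to\mathbb R$, let $V_x(m)=f_1(S^mx)$ and $H_x=\Delta+V_x$, and let $V_{\mathrm{per}}:\mathbb Z\to\mathbb R$ be periodic with period $p$. If $(\mathbb Z_p,+1)$ is a factor of $(\mathbb X,S)$, then for every $x\in\mathbb X$ the operator $H_x+V_{\mathrm{per}}$ has no eigenvalues.
   Context: $\Delta$ is the discrete Laplacian $(\Delta\psi)(n)=\psi(n+1)+\psi(n-1)$; $S$ is the left shift. Simple Toeplitz subshift: given a coding sequence $s=(b_k,n_k)_{k\in\mathbb N}$ with $b_k\in\mathcal A$, $n_k\ge 2$, and $(b_k)$ not eventually constant, define words $\widetilde w_1=b_1$ and $\widetilde w_{k+1}=\widetilde w_k^{n_k}b_k^{-1}b_{k+1}$ (i.e. $\widetilde w_k^{n_k}$ with its last letter $b_k$ replaced by $b_{k+1}$). Each $\widetilde w_k$ is a prefix of $\widetilde w_{k+1}$, so they define a limit $x(s)\in\mathcal A^{\mathbb N}$; the simple Toeplitz subshift is $\mathbb X(s)=\{x\in\mathcal A^{\mathbb Z}: x_j\cdots x_k \text{ is a subword of } x(s) \text{ for all } j\le k\}$. $(\mathbb Z_p,+1)$ is a factor of $(\mathbb X,S)$ if there is a continuous surjection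 $\pi:\mathbb X\to\mathbb Z_p$ with $\pi(Sx)=\pi(x)+1 \bmod p$. *)

theory Defs
  imports "HOL-Analysis.Analysis"
begin

text \<open>Coding sequence s = (b_k, n_k), indexed here from k = 0 (the paper indexes from 1).
  toep_word b n k is the word w~_{k+1} of the paper.\<close>
fun toep_word :: "(nat \<Rightarrow> 'a) \<Rightarrow> (nat \<Rightarrow> nat) \<Rightarrow> nat \<Rightarrow> 'a list" where
  "toep_word b n 0 = [b 0]"
| "toep_word b n (Suc k) =
     butlast (concat (replicate (n k) (toep_word b n k))) @ [b (Suc k)]"

text \<open>The one-sided limit sequence x(s): its i-th letter is read off any word long enough.\<close>
definition toep_seq :: "(nat \<Rightarrow> 'a) \<Rightarrow> (nat \<Rightarrow> nat) \<Rightarrow> nat \<Rightarrow> 'a" where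
  "toep_seq b n i = toep_word b n (LEAST k. i < length (toep_word b n k)) ! i"

definition toep_subshift :: "(nat \<Rightarrow> 'a) \<Rightarrow> (nat \<Rightarrow> nat) \<Rightarrow> (int \<Rightarrow> 'a) set" where
  "toep_subshift b n = {x. \<forall>j k. j \<le> k \<longrightarrow>
       (\<exists>i. \<forall>t::nat. t \<le> nat (k - j) \<longrightarrow> x (j + int t) = toep_seq b n (i + t))}"

definition lshift :: "(int \<Rightarrow> 'a) \<Rightarrow> int \<Rightarrow> 'a" where
  "lshift x = (\<lambda>m. x (m + 1))"

text \<open>(Z_p,+1) is a (topological) factor of (X,S); Z_p = {0..<p} with its discrete topology
  (the topology of int), X with the product topology on int \<Rightarrow> real.\<close>
definition has_Zp_factor :: "(int \<Rightarrow> real) set \<Rightarrow> nat \<Rightarrow> bool" where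
  "has_Zp_factor X p \<longleftrightarrow> (\<exists>\<pi> :: (int \<Rightarrow> real) \<Rightarrow> int.
      continuous_on X \<pi> \<and> \<pi> ` X = {0..<int p} \<and>
      (\<forall>x\<in>X. \<pi> (lshift x) = (\<pi> x + 1) mod int p))"

definition is_eigenvalue :: "(int \<Rightarrow> real) \<Rightarrow> complex \<Rightarrow> bool" where
  "is_eigenvalue W E \<longleftrightarrow> (\<exists>\<psi> :: int \<Rightarrow> complex.
      (\<lambda>m. (norm (\<psi> m))\<^sup>2) summable_on UNIV \<and> \<psi> \<noteq> (\<lambda>_. 0) \<and>
      (\<forall>m. \<psi> (m + 1) + \<psi> (m - 1) + of_real (W m) * \<psi> m = E * \<psi> m))"

end

theory Submission
  imports Defs
begin

text \<open>Every point of the subshift has, for each \<open>k\<close>, a coset of \<open>n\<^sub>0 \<cdots> n\<^bsub>k-1\<^esub> \<int>\<close> (the holes of level \<open>k\<close>) such that the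
  cosets are nested and the letter at a hole of level \<open>k\<close> but not of level \<open>k + 1\<close> is \<open>b k\<close>. A factor
  \<open>\<int>\<^sub>p\<close> forces \<open>p\<close> to divide one of these periods, so that the periodic perturbation only changes the
  common block between the holes of a sufficiently high level.

  Let \<open>\<psi>\<close> be an eigenfunction. Restricted to the holes of level \<open>k\<close> it solves a discrete Schroedinger
  equation whose diagonal takes the two values \<open>tr A\<^sub>k\<close>, \<open>tr B\<^sub>k\<close>, where \<open>A\<^sub>k\<close> and \<open>B\<^sub>k\<close> are the
  monodromies of a level \<open>k\<close> block with letter \<open>b k\<close>, respectively the other letter, at the hole. By
  convexity these traces are not both at least 2 in modulus, and since \<open>\<bar>tr A\<bar> \<ge> 2\<close> implies
  \<open>\<bar>tr A\<^sup>n\<bar> \<ge> 2\<close>, infinitely many \<open>tr A\<^sub>k\<close> are bounded by 2. Gordon's argument then shows that \<open>\<psi>\<close> does not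
  decay, unless from some level on \<open>n k = 3\<close>, \<open>b (k + 1) \<noteq> b k\<close>, and the origin lies in the middle block.
  In that exceptional case \<open>A\<^bsub>k+1\<^esub> = A\<^sub>k B\<^sub>k A\<^sub>k\<close> and \<open>B\<^bsub>k+1\<^esub> = A\<^sub>k\<^sup>3\<close>, and decay forces both traces to tend to
  0. The commutators \<open>B\<^sub>k A\<^sub>k - A\<^sub>k B\<^sub>k\<close> are multiples of a fixed matrix with square
  \<open>(tr A\<^sub>k - tr B\<^sub>k)\<^sup>2 \<rightarrow> 0\<close>, whereas decay two blocks away from the origin makes them act on the state at
  the origin as multiplication by 2 in the limit.\<close>

subsection \<open>Unimodular 2 by 2 matrices\<close>

lemma matrix2_mult_nth: "((A::complex^2^2) ** B) $ i $ j = A$i$1 * B$1$j + A$i$2 * B$2$j"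
  by (simp add: matrix_matrix_mult_def sum_2)

lemma matrix2_vector_nth: "((A::complex^2^2) *v w) $ i = A$i$1 * w$1 + A$i$2 * w$2"
  by (simp add: matrix_vector_mult_def sum_2)

lemma trace_2: "trace (A::complex^2^2) = A$1$1 + A$2$2"
  by (simp add: trace_def sum_2)

lemma matrix2_eq_iff: "(A::complex^2^2) = B \<longleftrightarrow> A$1$1 = B$1$1 \<and> A$1$2 = B$1$2 \<and> A$2$1 = B$2$1 \<and> A$2$2 = B$2$2"
  by (auto simp: vec_eq_iff forall_2)

lemma vec2_eq_iff: "(v::complex^2) = w \<longleftrightarrow> v$1 = w$1 \<and> v$2 = w$2"
  by (auto simp: vec_eq_iff forall_2)

lemma cayley_hamilton2:
  fixes A :: "complex^2^2"
  assumes "det A = 1"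
  shows "A *v (A *v w) + w = trace A *s (A *v w)"
  using assms unfolding vec2_eq_iff det_2 trace_2 by (simp add: matrix2_vector_nth) algebra

lemma norm_vector_smult: "norm (z *s (w::complex^2)) = norm z * norm w"
  by (simp add: norm_vec_def L2_set_def norm_mult power_mult_distrib sum_2 real_sqrt_mult
     flip: distrib_left)

text \<open>The passage from \<open>(A, B)\<close> to \<open>(A B A, A\<^sup>3)\<close> is the renormalization step of the exceptional case
  \<open>n k = 3\<close> below; it changes the commutator by a scalar factor only.\<close>
lemma commutator_conj:
  fixes A B :: "complex^2^2"
  assumes "det A = 1"
  shows "((A**A**A) ** (A**B**A) - (A**B**A) ** (A**A**A)) *v w
    = (1 - (trace A)\<^sup>2) *s ((B**A - A**B) *v w)"
proof -
  have A2: "A ** A = (\<chi> i j. trace A * A$i$j - (if i = j then 1 else 0))"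
    using assms unfolding matrix2_eq_iff det_2 trace_2 by (simp add: matrix2_mult_nth) algebra
  define D where "D = A ** B - B ** A"
  have tD: "trace D = 0" "trace (D ** A) = 0"
    by (simp_all add: D_def trace_2 matrix2_mult_nth algebra_simps)
  have ADA: "A ** D ** A = D"
    using assms tD unfolding matrix2_eq_iff det_2 trace_2 by (simp add: matrix2_mult_nth) algebra
  have A3: "A ** A ** A = (\<chi> i j. ((trace A)\<^sup>2 - 1) * A$i$j - (if i = j then trace A else 0))"
    unfolding A2 using assms unfolding matrix2_eq_iff det_2 trace_2 by (simp add: matrix2_mult_nth) algebra
  have "(A**A**A) ** (A**B**A) - (A**B**A) ** (A**A**A) = (\<chi> i j. ((trace A)\<^sup>2 - 1) * (A ** D ** A)$i$j)"
    unfolding A3 D_def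
    by (simp add: matrix2_eq_iff matrix2_mult_nth algebra_simps)
  then show ?thesis
    unfolding ADA by (simp add: vec2_eq_iff matrix2_vector_nth D_def algebra_simps)
qed

text \<open>A commutator has trace 0, so by Cayley-Hamilton its square is minus its determinant.
  Since \<open>det (A - B) = 0\<close> fixes the trace of A times the inverse of B at 2, only the
  two traces remain.\<close>

lemma commutator_sq:
  fixes A B :: "complex^2^2"
  assumes "det A = 1" "det B = 1" "det (A - B) = 0"
  shows "(B**A - A**B) *v ((B**A - A**B) *v w) = (trace A - trace B)\<^sup>2 *s w"
proof -
  define D where "D = B ** A - A ** B"
  have t: "D$2$2 = - D$1$1" by (simp add: D_def matrix2_mult_nth algebra_simps)
  have d: "D$1$1 * D$1$1 + D$1$2 * D$2$1 = (trace A - trace B)\<^sup>2"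
    using assms unfolding D_def det_2 trace_2 by (simp add: matrix2_mult_nth) algebra
  show ?thesis unfolding D_def[symmetric] vec2_eq_iff d[symmetric]
    by (simp add: matrix2_vector_nth t algebra_simps)
qed

text \<open>The inverse of B is \<open>trace B\<close> times the identity minus B, and A times this
  inverse has trace 2.\<close>

lemma trace_mult_rank_one:
  fixes A B :: "complex^2^2"
  assumes "det A = 1" "det B = 1" "det (A - B) = 0"
  shows "trace (A ** B) = trace A * trace B - 2"
  using assms unfolding det_2 trace_2 by (simp add: matrix2_mult_nth) algebra

lemma trace_cube:
  fixes A :: "complex^2^2"
  assumes "det A = 1"
  shows "trace (A ** A ** A) = trace A ^ 3 - 3 * trace A"
  using assms unfolding det_2 trace_2 by (simp add: matrix2_mult_nth) algebra

definition mpow :: "complex^2^2 \<Rightarrow> nat \<Rightarrow> complex^2^2" where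
  "mpow A j = ((**) A ^^ j) (mat 1)"

lemma mpow_simps [simp]: "mpow A 0 = mat 1" "mpow A (Suc j) = A ** mpow A j"
  by (simp_all add: mpow_def)

lemma mpow_add: "mpow A (i + j) = mpow A i ** mpow A j"
  by (induction i) (simp_all add: matrix_mul_assoc)

lemma det_mpow: "det A = 1 \<Longrightarrow> det (mpow A j) = 1"
  by (induction j) (simp_all add: det_mul)

lemma trace_mpow_rec:
  assumes "det A = 1"
  shows "trace (mpow A (Suc (Suc j))) = trace A * trace (mpow A (Suc j)) - trace (mpow A j)"
  using assms unfolding mpow_simps det_2 trace_2 by (simp add: matrix2_mult_nth) algebra

text \<open>By the recurrence the moduli of these traces form a convex sequence; its first two terms
  are 2 and at least 2, so it never decreases.\<close>

lemma norm_trace_mpow: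
  assumes "det A = 1" "2 \<le> norm (trace A)"
  shows "2 \<le> norm (trace (mpow A j))"
proof -
  have "2 \<le> norm (trace (mpow A j)) \<and> norm (trace (mpow A j)) \<le> norm (trace (mpow A (Suc j)))"
  proof (induction j)
    case 0
    show ?case using assms by (simp add: trace_I)
  next
    case (Suc j)
    let ?u = "norm (trace (mpow A j))" and ?v = "norm (trace (mpow A (Suc j)))"
    have "2 * ?v \<le> norm (trace A) * ?v"
      using assms by (intro mult_right_mono) auto
    also have "\<dots> = norm (trace (mpow A (Suc (Suc j))) + trace (mpow A j))"
      using trace_mpow_rec[OF assms(1), of j] by (simp add: norm_mult del: mpow_simps)
    also have "\<dots> \<le> norm (trace (mpow A (Suc (Suc j)))) + ?u"
      by (rule norm_triangle_ineq)
    finally show ?case using Suc by linarith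
  qed
  then show ?thesis by simp
qed

section \<open>Functions on the integers that vanish at infinity\<close>

lemma cofinite_vanish_not_ge:
  fixes f :: "int \<Rightarrow> real"
  assumes "(f \<longlongrightarrow> 0) cofinite" "inj h" "\<And>i::nat. f (h i) \<ge> e"
  shows "e \<le> 0"
proof (rule ccontr)
  assume "\<not> e \<le> 0"
  then have "eventually (\<lambda>j. f j < e) cofinite"
    using assms(1) by (auto intro: order_tendstoD)
  then have "finite {j. \<not> f j < e}" by (simp add: eventually_cofinite)
  moreover have "range h \<subseteq> {j. \<not> f j < e}" using assms(3) by (auto simp: not_less)
  ultimately have "finite (range h)" by (rule rev_finite_subset)
  then show False using assms(2) by (simp add: finite_image_iff)
qed

text \<open>By convexity f is at least as high at a neighbour of j, and from there it never falls in
  that direction; a positive \<open>f j\<close> would bound infinitely many values from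
  below.\<close>

lemma vanishing_midconvex:
  fixes f :: "int \<Rightarrow> real"
  assumes "(f \<longlongrightarrow> 0) cofinite" and conv: "\<And>j. 2 * f j \<le> f (j + 1) + f (j - 1)"
  shows "f j \<le> 0"
proof -
  consider "f j \<le> f (j + 1)" | "f j \<le> f (j - 1)" using conv[of j] by linarith
  then show ?thesis
  proof cases
    case 1
    have "f j \<le> f (j + int i) \<and> f (j + int i) \<le> f (j + int i + 1)" for i
    proof (induction i)
      case (Suc i)
      then show ?case using conv[of "j + int i + 1"] by (simp add: algebra_simps)
    qed (use 1 in simp)
    then show ?thesis
      by (intro cofinite_vanish_not_ge[OF assms(1), of "\<lambda>i. j + int i"]) (auto simp: inj_def)
  next
    case 2
    have "f j \<le> f (j - int i) \<and> f (j - int i) \<le> f (j - int i - 1)" for i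
    proof (induction i)
      case (Suc i)
      then show ?case using conv[of "j - int i - 1"] by (simp add: algebra_simps)
    qed (use 2 in simp)
    then show ?thesis
      by (intro cofinite_vanish_not_ge[OF assms(1), of "\<lambda>i. j - int i"]) (auto simp: inj_def)
  qed
qed

lemma vanishing_recurrence:
  fixes \<phi> \<tau> :: "int \<Rightarrow> complex"
  assumes "(\<phi> \<longlongrightarrow> 0) cofinite" "\<And>j. \<phi> (j + 1) + \<phi> (j - 1) = \<tau> j * \<phi> j" "\<And>j. 2 \<le> norm (\<tau> j)"
  shows "\<phi> j = 0"
proof -
  have "2 * norm (\<phi> j) \<le> norm (\<phi> (j + 1)) + norm (\<phi> (j - 1))" for j
  proof -
    have "2 * norm (\<phi> j) \<le> norm (\<tau> j) * norm (\<phi> j)"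
      using assms(3) by (intro mult_right_mono) auto
    also have "\<dots> = norm (\<phi> (j + 1) + \<phi> (j - 1))" by (simp add: assms(2) norm_mult)
    finally show ?thesis using norm_triangle_ineq[of "\<phi> (j + 1)" "\<phi> (j - 1)"] by linarith
  qed
  then show ?thesis
    using vanishing_midconvex[of "\<lambda>j. norm (\<phi> j)" j] tendsto_norm[OF assms(1)] by simp
qed

text \<open>\<open>\<rho> * \<rho> + 1 \<ge> 2 * \<rho>\<close> makes the norms midpoint convex, so
  growing and decaying sequences need no separate treatment.\<close>

lemma vanishing_geometric:
  fixes w :: "int \<Rightarrow> complex"
  assumes "(w \<longlongrightarrow> 0) cofinite" "\<And>j. w (j + 1) = \<kappa> * w j" "\<kappa> \<noteq> 0"
  shows "w j = 0"
proof -
  define \<rho> where "\<rho> = norm \<kappa>"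
  have \<rho>: "\<rho> > 0" using assms(3) by (simp add: \<rho>_def)
  have "2 * norm (w j) \<le> norm (w (j + 1)) + norm (w (j - 1))" for j
  proof -
    have s: "norm (w (j + 1)) = \<rho> * norm (w j)" by (simp add: assms(2) norm_mult \<rho>_def)
    have p: "norm (w j) = \<rho> * norm (w (j - 1))"
      using assms(2)[of "j - 1"] by (simp add: norm_mult \<rho>_def)
    have "2 * \<rho> * norm (w (j - 1)) \<le> (\<rho> * \<rho> + 1) * norm (w (j - 1))"
      using sum_squares_bound[of \<rho> 1] by (intro mult_right_mono) (auto simp: power2_eq_square)
    then show ?thesis unfolding s p by (simp add: algebra_simps)
  qed
  then show ?thesis
    using vanishing_midconvex[of "\<lambda>j. norm (w j)" j] tendsto_norm[OF assms(1)] by simp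
qed

section \<open>One-step transfer matrices\<close>

definition step :: "complex \<Rightarrow> complex^2^2" where
  "step z = vector [vector [z, -1], vector [1, 0]]"

lemma step_nth [simp]: "step z $ 1 $ 1 = z" "step z $ 1 $ 2 = -1" "step z $ 2 $ 1 = 1" "step z $ 2 $ 2 = 0"
  by (simp_all add: step_def)

lemma det_step: "det (step z) = 1" by (simp add: det_2)

lemma det_step_diff: "det (step z - step z') = 0" by (simp add: det_2)

lemma tendsto_matrix_vector:
  fixes A :: "complex^2^2"
  assumes "(f \<longlongrightarrow> w) F"
  shows "((\<lambda>j. A *v f j) \<longlongrightarrow> A *v w) F"
  unfolding matrix_vector_mult_def
  by (intro tendsto_vec_lambda tendsto_sum tendsto_mult tendsto_const tendsto_vec_nth assms)

text \<open>The first component of \<open>\<Phi>\<close> satisfies a three-term recurrence whose diagonal is the trace of the cocycle.\<close>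
lemma decimation:
  fixes \<Phi> :: "int \<Rightarrow> complex^2"
  assumes "(\<Phi> \<longlongrightarrow> 0) cofinite" and N: "det N = 1"
    and rec: "\<And>j. \<Phi> (j + 1) = (N ** step (c j)) *v \<Phi> j"
    and tr: "\<And>j. 2 \<le> norm (trace (N ** step (c j)))"
  shows "\<Phi> j = 0"
proof -
  have lim: "((\<lambda>j. \<Phi> j $ i) \<longlongrightarrow> 0) cofinite" for i
    using tendsto_vec_nth[OF assms(1), of i] by simp
  have s: "\<Phi> (j + 1) $ i = N$i$1 * (c j * \<Phi> j $ 1 - \<Phi> j $ 2) + N$i$2 * \<Phi> j $ 1" for i j
    unfolding rec by (simp add: matrix2_vector_nth matrix2_mult_nth algebra_simps)
  have d: "N$1$1 * N$2$2 - N$1$2 * N$2$1 = 1" using N by (simp add: det_2)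
  have fst0: "\<Phi> j $ 1 = 0" for j
  proof (rule vanishing_recurrence[OF lim _ tr])
    fix j
    show "\<Phi> (j + 1) $ 1 + \<Phi> (j - 1) $ 1 = trace (N ** step (c j)) * \<Phi> j $ 1"
      using s[of j 1] s[of "j - 1" 1] s[of "j - 1" 2] d unfolding trace_2
      by (simp add: matrix2_mult_nth) algebra
  qed
  \<comment> \<open>This kills the second component unless \<open>N$1$1\<close> is 0; then the
    second components form a geometric sequence, whose ratio is nonzero by
    \<open>det N = 1\<close>.\<close>
  have sndm: "N$1$1 * \<Phi> j $ 2 = 0" for j using s[of j 1] by (simp add: fst0)
  have "\<Phi> j $ 2 = 0"
  proof (cases "N$1$1 = 0")
    case True
    show ?thesis
    proof (rule vanishing_geometric[OF lim, of _ "- N$2$1"])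
      show "\<Phi> (j + 1) $ 2 = - N$2$1 * \<Phi> j $ 2" for j using s[of j 2] by (simp add: fst0)
      show "- N$2$1 \<noteq> 0" using d True by auto
    qed
  qed (use sndm in auto)
  with fst0 show ?thesis by (simp add: vec2_eq_iff)
qed

subsection \<open>Decaying orbits of hierarchical cocycles\<close>

lemma eq_of_two_elements:
  "p \<in> {\<alpha>, \<gamma>} \<Longrightarrow> q \<in> {\<alpha>, \<gamma>} \<Longrightarrow> r \<in> {\<alpha>, \<gamma>} \<Longrightarrow> p \<noteq> r \<Longrightarrow> q \<noteq> r \<Longrightarrow> p = q"
  by auto

lemma filterlim_cofinite_inj:
  fixes h :: "'a \<Rightarrow> 'b"
  assumes "inj h"
  shows "filterlim h cofinite cofinite"
  unfolding filterlim_iff eventually_cofinite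
proof (intro allI impI)
  fix P :: "'b \<Rightarrow> bool" assume "finite {x. \<not> P x}"
  from finite_vimageI[OF this assms] show "finite {x. \<not> P (h x)}" by (simp add: vimage_def)
qed

text \<open>\<open>\<Omega> k i\<close> stands for the state \<open>(\<psi> m, \<psi> (m - 1))\<close> at the left end \<open>m\<close> of the \<open>i\<close>-th block of level \<open>k\<close>,
  \<open>c k i\<close> for \<open>E\<close> minus the potential at the hole of that block, and \<open>s k\<close> for the position of the hole of a
  block of level \<open>k + 1\<close> among its \<open>n k\<close> subblocks. \<open>X0\<close> and \<open>Y0\<close> transfer across the parts of a level 0
  block before and after its hole. Block 0 always starts at the origin, which need not be a hole.\<close>
locale toeplitz_cocycle =
  fixes \<Omega> :: "nat \<Rightarrow> int \<Rightarrow> complex^2" and c :: "nat \<Rightarrow> int \<Rightarrow> complex"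
    and n s :: "nat \<Rightarrow> nat" and \<beta> :: "nat \<Rightarrow> complex" and \<alpha> \<gamma> :: complex
    and X0 Y0 :: "complex^2^2"
  assumes n_ge: "2 \<le> n k" and s_less: "s k < n k"
    and \<Omega>_Suc: "\<Omega> (Suc k) i = \<Omega> k (int (n k) * i)"
    and c_Suc: "c (Suc k) i = c k (int (s k) + int (n k) * i)"
    and c_regular: "i mod int (n k) \<noteq> int (s k) \<Longrightarrow> c k i = \<beta> k"
    and c_range: "c 0 i \<in> {\<alpha>, \<gamma>}" and \<beta>_range: "\<beta> k \<in> {\<alpha>, \<gamma>}"
    and \<beta>_changes: "\<alpha> = \<gamma> \<or> (\<forall>K. \<exists>k\<ge>K. \<beta> k \<noteq> \<beta> (Suc k))"
    and det0: "det X0 = 1" "det Y0 = 1"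
    and \<Omega>_rec0: "\<Omega> 0 (i + 1) = (Y0 ** step (c 0 i) ** X0) *v \<Omega> 0 i"
    and \<Omega>_lim: "(\<Omega> 0 \<longlongrightarrow> 0) cofinite"
begin

text \<open>Separating the parts before and after the hole lets the letter at the hole vary. On the
  next level, \<open>s k\<close> regular blocks precede the block with the hole and
  \<open>n k - 1 - s k\<close> follow it.\<close>

primrec XY :: "nat \<Rightarrow> (complex^2^2) \<times> (complex^2^2)" where
  "XY 0 = (X0, Y0)"
| "XY (Suc k) = (let X = fst (XY k); Y = snd (XY k); A = Y ** step (\<beta> k) ** X
     in (X ** mpow A (s k), mpow A (n k - 1 - s k) ** Y))"

definition M :: "nat \<Rightarrow> complex \<Rightarrow> complex^2^2" where
  "M k z = snd (XY k) ** step z ** fst (XY k)"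

lemma M_Suc: "M (Suc k) z = mpow (M k (\<beta> k)) (n k - 1 - s k) ** M k z ** mpow (M k (\<beta> k)) (s k)"
  by (simp add: M_def Let_def matrix_mul_assoc)

lemma det_XY: "det (fst (XY k)) = 1 \<and> det (snd (XY k)) = 1"
  by (induction k) (simp_all add: det0 Let_def det_mul det_step det_mpow)

lemma det_M: "det (M k z) = 1"
  by (simp add: M_def det_mul det_XY det_step)

lemma det_M_diff: "det (M k z - M k z') = 0"
proof -
  have "M k z - M k z' = snd (XY k) ** (step z - step z') ** fst (XY k)"
    by (simp add: M_def matrix2_eq_iff matrix2_mult_nth algebra_simps)
  then show ?thesis by (simp add: det_mul det_step_diff)
qed

text \<open>\<open>decimation\<close> needs the hole step as the rightmost factor: it looks at the
  state at the hole, not at the left end of the block.\<close>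

lemma trace_M: "trace (M k z) = trace (fst (XY k) ** snd (XY k) ** step z)"
  unfolding M_def by (subst trace_mul_sym) (simp add: matrix_mul_assoc)

lemma trace_M_Suc_\<beta>: "trace (M (Suc k) (\<beta> k)) = trace (mpow (M k (\<beta> k)) (n k))"
proof -
  let ?A = "M k (\<beta> k)"
  have "trace (M (Suc k) (\<beta> k)) = trace (mpow ?A (s k) ** (mpow ?A (n k - 1 - s k) ** ?A))"
    unfolding M_Suc by (rule trace_mul_sym)
  also have "mpow ?A (s k) ** (mpow ?A (n k - 1 - s k) ** ?A) = mpow ?A (s k + (n k - 1 - s k)) ** mpow ?A 1"
    by (simp add: mpow_add matrix_mul_assoc)
  also have "\<dots> = mpow ?A (n k)"
    using s_less[of k] by (simp flip: mpow_add del: mpow_simps)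
  finally show ?thesis .
qed

lemma c_cases: "c k i \<in> {\<alpha>, \<gamma>}"
  by (induction k arbitrary: i) (use c_range in \<open>auto simp: c_Suc\<close>)

lemma \<Omega>_rec: "\<Omega> k (i + 1) = M k (c k i) *v \<Omega> k i"
proof (induction k arbitrary: i)
  case 0
  then show ?case by (simp add: \<Omega>_rec0 M_def)
next
  case (Suc k)
  let ?A = "M k (\<beta> k)" and ?n = "int (n k)" and ?s = "int (s k)"
  have step: "\<Omega> k (i + 1) = M k (c k i) *v \<Omega> k i" for i by (rule Suc.IH)
  have run: "\<Omega> k (m + int j) = mpow ?A j *v \<Omega> k m" if "\<And>l. l < j \<Longrightarrow> c k (m + int l) = \<beta> k" for m j
    using that
  proof (induction j)
    case (Suc j)
    have "\<Omega> k (m + int (Suc j)) = ?A *v \<Omega> k (m + int j)"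
      using step[of "m + int j"] Suc.prems[of j] by (simp add: add_ac)
    then show ?case using Suc by (simp add: matrix_vector_mul_assoc)
  qed simp
  have reg: "c k (?n * i + int l) = \<beta> k" if "l < n k" "l \<noteq> s k" for l
    using that by (intro c_regular) simp
  have 1: "\<Omega> k (?n * i + ?s) = mpow ?A (s k) *v \<Omega> k (?n * i)"
    using s_less[of k] by (intro run reg) auto
  have 2: "\<Omega> k (?n * i + ?s + 1) = M k (c (Suc k) i) *v \<Omega> k (?n * i + ?s)"
    using step[of "?n * i + ?s"] by (simp add: c_Suc add_ac)
  have "c k (?n * i + ?s + 1 + int l) = \<beta> k" if "l < n k - 1 - s k" for l
    using reg[of "s k + 1 + l"] that by (simp add: algebra_simps)
  then have "\<Omega> k (?n * i + ?s + 1 + int (n k - 1 - s k))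
      = mpow ?A (n k - 1 - s k) *v \<Omega> k (?n * i + ?s + 1)"
    by (rule run)
  moreover have "?n * i + ?s + 1 + int (n k - 1 - s k) = ?n * (i + 1)"
    using s_less[of k] by (simp add: algebra_simps of_nat_diff)
  ultimately show ?case
    by (simp add: \<Omega>_Suc M_Suc 1 2 matrix_vector_mul_assoc matrix_mul_assoc)
qed

definition Q :: "nat \<Rightarrow> int" where "Q k = (\<Prod>j<k. int (n j))"

lemma Q_Suc: "Q (Suc k) = Q k * int (n k)" by (simp add: Q_def)

lemma Q_pos: "0 < Q k"
proof -
  have "0 < n k" for k using n_ge[of k] by simp
  then show ?thesis unfolding Q_def by (intro prod_pos) simp
qed

lemma \<Omega>_eq: "\<Omega> k i = \<Omega> 0 (Q k * i)"
  by (induction k arbitrary: i) (simp_all add: Q_def \<Omega>_Suc mult_ac)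

lemma strict_mono_Q: "strict_mono Q"
proof (rule strict_monoI_Suc)
  fix k
  have "Q k * 1 < Q k * int (n k)" using Q_pos[of k] n_ge[of k] by (intro mult_strict_left_mono) auto
  then show "Q k < Q (Suc k)" by (simp add: Q_Suc)
qed

lemma \<Omega>_level_lim: "(\<Omega> k \<longlongrightarrow> 0) cofinite"
proof -
  have "inj (\<lambda>i. Q k * i)" using Q_pos[of k] by (auto simp: inj_def)
  then have "filterlim (\<lambda>i. Q k * i) cofinite cofinite"
    by (rule filterlim_cofinite_inj)
  from filterlim_compose[OF \<Omega>_lim this] show ?thesis by (simp flip: \<Omega>_eq)
qed

lemma \<Omega>_scale_lim:
  assumes "i \<noteq> 0"
  shows "(\<lambda>k. \<Omega> k i) \<longlonglongrightarrow> 0"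
proof -
  have "inj (\<lambda>k. Q k * i)"
    using strict_mono_eq[OF strict_mono_Q] assms by (auto simp: inj_def)
  then have "filterlim (\<lambda>k. Q k * i) cofinite sequentially"
    unfolding cofinite_eq_sequentially[symmetric]
    by (rule filterlim_cofinite_inj)
  from filterlim_compose[OF \<Omega>_lim this] show ?thesis by (simp flip: \<Omega>_eq)
qed

lemma \<Omega>_zero: "\<Omega> k 0 = \<Omega> 0 0" using \<Omega>_eq[of k 0] by simp

section \<open>Gordon's argument\<close>

lemma small_trace_exists:
  assumes "\<Omega> 0 0 \<noteq> 0"
  obtains z where "z \<in> {\<alpha>, \<gamma>}" "norm (trace (M k z)) < 2"
proof -
  have "\<exists>i. norm (trace (M k (c k i))) < 2"
  proof (rule ccontr)
    assume neg: "\<nexists>i. norm (trace (M k (c k i))) < 2"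
    \<comment> \<open>The state at the hole; it vanishes only together with the state at the left
      end of the block.\<close>
    define \<Phi> where "\<Phi> = (\<lambda>i. fst (XY k) *v \<Omega> k i)"
    have "\<Phi> 0 = 0"
    proof (rule decimation)
      show "(\<Phi> \<longlongrightarrow> 0) cofinite"
        unfolding \<Phi>_def using tendsto_matrix_vector[OF \<Omega>_level_lim[of k], of "fst (XY k)"] by simp
      show "det (fst (XY k) ** snd (XY k)) = 1" by (simp add: det_mul det_XY)
      show "\<Phi> (j + 1) = (fst (XY k) ** snd (XY k) ** step (c k j)) *v \<Phi> j" for j
        by (simp add: \<Phi>_def \<Omega>_rec M_def matrix_vector_mul_assoc matrix_mul_assoc)
      show "2 \<le> norm (trace (fst (XY k) ** snd (XY k) ** step (c k j)))" for j
        using neg by (simp add: not_less trace_M)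
    qed
    then have "fst (XY k) *v \<Omega> 0 0 = 0" by (simp add: \<Phi>_def \<Omega>_zero[of k])
    moreover obtain B where "B ** fst (XY k) = mat 1"
      using det_XY[of k] invertible_det_nz[of "fst (XY k)"] invertible_left_inverse[of "fst (XY k)"] by auto
    then have "\<Omega> 0 0 = B *v (fst (XY k) *v \<Omega> 0 0)"
      by (simp add: matrix_vector_mul_assoc)
    ultimately show False using assms by simp
  qed
  then obtain i where "norm (trace (M k (c k i))) < 2" by blast
  with c_cases show thesis by (rule that)
qed

text \<open>Where the letter changes, a trace above 2 for \<open>\<beta> k\<close> stays at least 2
  on the next level, as the trace of a power. There the small trace must belong to the other letter,
  \<open>\<beta> (Suc k)\<close>.\<close>

lemma small_trace_infinitely_often:
  assumes "\<Omega> 0 0 \<noteq> 0"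
  shows "\<exists>k\<ge>K. norm (trace (M k (\<beta> k))) \<le> 2"
proof (cases "\<alpha> = \<gamma>")
  case True
  obtain z where "z \<in> {\<alpha>, \<gamma>}" "norm (trace (M K z)) < 2" by (rule small_trace_exists[OF assms])
  then have "norm (trace (M K (\<beta> K))) \<le> 2" using True \<beta>_range[of K] by auto
  then show ?thesis by auto
next
  case False
  then obtain k where k: "k \<ge> K" "\<beta> k \<noteq> \<beta> (Suc k)" using \<beta>_changes by blast
  show ?thesis
  proof (cases "norm (trace (M k (\<beta> k))) \<le> 2")
    case False
    then have big: "2 \<le> norm (trace (M (Suc k) (\<beta> k)))"
      unfolding trace_M_Suc_\<beta> by (intro norm_trace_mpow) (auto simp: det_M)
    obtain z where "z \<in> {\<alpha>, \<gamma>}" "norm (trace (M (Suc k) z)) < 2" by (rule small_trace_exists[OF assms])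
    moreover have "{\<alpha>, \<gamma>} = {\<beta> k, \<beta> (Suc k)}" using k \<beta>_range[of k] \<beta>_range[of "Suc k"] by auto
    ultimately have "norm (trace (M (Suc k) (\<beta> (Suc k)))) \<le> 2" using big by auto
    then show ?thesis using k by (intro exI[of _ "Suc k"]) auto
  qed (use k in auto)
qed

lemma three_term:
  assumes "c k i = z" "c k (i + 1) = z"
  shows "\<Omega> k (i + 2) + \<Omega> k i = trace (M k z) *s \<Omega> k (i + 1)"
  using cayley_hamilton2[OF det_M, of k z "\<Omega> k i"] \<Omega>_rec[of k i] \<Omega>_rec[of k "i + 1"] assms
  by (simp add: add.assoc)

lemma c_regular_nat: "j < n k \<Longrightarrow> j \<noteq> s k \<Longrightarrow> c k (int (n k) * q + int j) = \<beta> k"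
  by (intro c_regular) simp

lemma c_near:
  "s k \<noteq> 0 \<Longrightarrow> c k 0 = \<beta> k" "s k \<noteq> 1 \<Longrightarrow> c k 1 = \<beta> k"
  "s k \<noteq> n k - 1 \<Longrightarrow> c k (-1) = \<beta> k" "s k \<noteq> n k - 2 \<Longrightarrow> c k (-2) = \<beta> k"
  using c_regular_nat[of 0 k 0] c_regular_nat[of 1 k 0] c_regular_nat[of "n k - 1" k "-1"]
    c_regular_nat[of "n k - 2" k "-1"] n_ge[of k]
  by (simp_all add: of_nat_diff)

text \<open>Gordon's argument uses two blocks on either side of the origin. With a trace of modulus
  at most 2, the factor 1/4 gives 2/4 + 1/4 < 1.\<close>

definition negligible :: "nat \<Rightarrow> bool" where
  "negligible k \<longleftrightarrow> (\<forall>i\<in>{1, -1, 2, -2}. norm (\<Omega> k i) < norm (\<Omega> 0 0) / 4)"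

lemma eventually_negligible:
  assumes "\<Omega> 0 0 \<noteq> 0"
  shows "eventually negligible sequentially"
proof -
  have "eventually (\<lambda>k. norm (\<Omega> k i) < norm (\<Omega> 0 0) / 4) sequentially" if "i \<noteq> 0" for i
    using tendsto_norm[OF \<Omega>_scale_lim[OF that]] assms by (intro order_tendstoD) auto
  then show ?thesis
    unfolding negligible_def by (simp add: eventually_conj_iff)
qed

text \<open>For two equal blocks that start or end at the origin, Cayley-Hamilton would bound the
  state there by 3/4 of its own norm.\<close>

lemma no_square_beside:
  assumes "negligible k" "norm (trace (M k (\<beta> k))) \<le> 2"
  shows "\<not> (c k 0 = \<beta> k \<and> c k 1 = \<beta> k)" "\<not> (c k (-2) = \<beta> k \<and> c k (-1) = \<beta> k)"
proof -
  let ?t = "trace (M k (\<beta> k))"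
  have "False" if "\<Omega> k j + \<Omega> 0 0 = ?t *s \<Omega> k i" "i \<in> {1, -1, 2, -2}" "j \<in> {1, -1, 2, -2}" for i j
  proof -
    have small: "norm (\<Omega> k i) < norm (\<Omega> 0 0) / 4" "norm (\<Omega> k j) < norm (\<Omega> 0 0) / 4"
      using assms(1) that(2,3) unfolding negligible_def by blast+
    have "norm (\<Omega> 0 0) = norm (?t *s \<Omega> k i - \<Omega> k j)"
      using that(1) by (metis add_diff_cancel_left')
    also have "\<dots> \<le> norm ?t * norm (\<Omega> k i) + norm (\<Omega> k j)"
      using norm_triangle_ineq4[of "?t *s \<Omega> k i" "\<Omega> k j"] by (simp add: norm_vector_smult)
    also have "\<dots> \<le> 2 * norm (\<Omega> k i) + norm (\<Omega> k j)"
      using assms(2) by (intro add_right_mono mult_right_mono) auto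
    finally show False using small norm_ge_zero[of "\<Omega> 0 0"] by linarith
  qed
  from this[of 2 1] this[of "-2" "-1"]
  show "\<not> (c k 0 = \<beta> k \<and> c k 1 = \<beta> k)" "\<not> (c k (-2) = \<beta> k \<and> c k (-1) = \<beta> k)"
    using three_term[of k 0 "\<beta> k"] three_term[of k "-2" "\<beta> k"] \<Omega>_zero[of k]
    by (auto simp: add.commute)
qed

text \<open>Blocks 0, 1 must contain a letter other than \<open>\<beta> k\<close>, and so must
  blocks -2, -1. This leaves (0,2), (1,2) and (1,3) for \<open>(s k, n k)\<close>, and the
  exceptional letters pass to blocks 0 and -1 of level k + 1.\<close>

lemma small_trace_next:
  assumes "negligible k" "norm (trace (M k (\<beta> k))) \<le> 2"
  shows "\<beta> (Suc k) \<noteq> \<beta> k" "c (Suc k) 0 = \<beta> (Suc k)" "c (Suc k) (-1) = \<beta> (Suc k)"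
proof -
  note sq = no_square_beside[OF assms] and near = c_near[of k]
  have next_c: "c (Suc k) 0 = c k (int (s k))" "c (Suc k) (-1) = c k (int (s k) - int (n k))"
    using c_Suc[of k 0] c_Suc[of k "-1"] by simp_all
  have ne: "c (Suc k) 0 \<noteq> \<beta> k \<and> c (Suc k) (-1) \<noteq> \<beta> k"
  proof -
    consider "s k = 0" | "s k = 1" | "s k \<ge> 2" by linarith
    then show ?thesis
    proof cases
      case 1
      then have n2: "n k = 2" using sq near n_ge[of k] by force
      show ?thesis using sq near 1 unfolding next_c n2 by simp
    next
      case 2
      then have "n k = 2 \<or> n k = 3" using sq near n_ge[of k] by force
      then show ?thesis using sq near 2 unfolding next_c by auto
    next
      case 3
      then show ?thesis using sq near by simp
    qed
  qed
  \<comment> \<open>As \<open>n (Suc k)\<close> is at least 2, two adjacent blocks are not both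
    exceptional.\<close>
  moreover have "c (Suc k) 0 = \<beta> (Suc k) \<or> c (Suc k) (-1) = \<beta> (Suc k)"
    using c_near(1,3)[of "Suc k"] n_ge[of "Suc k"] by force
  moreover have "c (Suc k) 0 = c (Suc k) (-1)"
    using eq_of_two_elements[OF c_cases c_cases \<beta>_range] ne by blast
  ultimately show "\<beta> (Suc k) \<noteq> \<beta> k" "c (Suc k) 0 = \<beta> (Suc k)" "c (Suc k) (-1) = \<beta> (Suc k)"
    by metis+
qed

lemma square_around:
  assumes "c k 0 = \<beta> k" "c k (-1) = \<beta> k"
  shows "trace (M k (\<beta> k)) *s \<Omega> 0 0 = \<Omega> k 1 + \<Omega> k (-1)"
  using three_term[of k "-1" "\<beta> k"] assms \<Omega>_zero[of k] by simp

text \<open>Equal blocks on both sides of the origin have a small trace by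
  \<open>square_around\<close>, so \<open>small_trace_next\<close> reproduces the configuration one
  level up. The exceptional letters can then only sit on blocks 1 and -2.\<close>

lemma square_around_next:
  assumes "\<Omega> 0 0 \<noteq> 0" "negligible k" "c k 0 = \<beta> k" "c k (-1) = \<beta> k"
  shows "n k = 3" "s k = 1" "c k 1 = \<beta> (Suc k)" "c k (-2) = \<beta> (Suc k)" "\<beta> (Suc k) \<noteq> \<beta> k"
    "c (Suc k) 0 = \<beta> (Suc k)" "c (Suc k) (-1) = \<beta> (Suc k)"
proof -
  have "norm (trace (M k (\<beta> k))) * norm (\<Omega> 0 0) \<le> norm (\<Omega> k 1) + norm (\<Omega> k (-1))"
    using norm_triangle_ineq[of "\<Omega> k 1" "\<Omega> k (-1)"]
    by (simp flip: norm_vector_smult square_around[OF assms(3,4)])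
  also have "\<dots> \<le> 2 * norm (\<Omega> 0 0)"
  proof -
    have "norm (\<Omega> k 1) < norm (\<Omega> 0 0) / 4" "norm (\<Omega> k (-1)) < norm (\<Omega> 0 0) / 4"
      using assms(2) by (simp_all add: negligible_def)
    then show ?thesis using norm_ge_zero[of "\<Omega> 0 0"] by linarith
  qed
  finally have tr: "norm (trace (M k (\<beta> k))) \<le> 2" using assms(1) by simp
  note sq = no_square_beside[OF assms(2) tr] and nxt = small_trace_next[OF assms(2) tr]
  show s: "s k = 1" using sq assms c_near[of k] by auto
  have "s k = n k - 2" using sq assms c_near[of k] by auto
  then show n: "n k = 3" using s n_ge[of k] by simp
  show "c k 1 = \<beta> (Suc k)" "c k (-2) = \<beta> (Suc k)"
    using nxt c_Suc[of k 0] c_Suc[of k "-1"] s n by simp_all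
  show "\<beta> (Suc k) \<noteq> \<beta> k" "c (Suc k) 0 = \<beta> (Suc k)" "c (Suc k) (-1) = \<beta> (Suc k)"
    by (rule nxt)+
qed

theorem \<Omega>_vanishes: "\<Omega> 0 0 = 0"
proof (rule ccontr)
  assume nz: "\<Omega> 0 0 \<noteq> 0"
  define \<omega> where "\<omega> = \<Omega> 0 0"
  obtain K0 where K0: "\<And>k. k \<ge> K0 \<Longrightarrow> negligible k"
    using eventually_negligible[OF nz] by (auto simp: eventually_sequentially)
  obtain K1 where K1: "K1 \<ge> K0" "norm (trace (M K1 (\<beta> K1))) \<le> 2"
    using small_trace_infinitely_often[OF nz] by blast
  define K where "K = Suc K1"
  have around: "c k 0 = \<beta> k \<and> c k (-1) = \<beta> k" if "k \<ge> K" for k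
    using that
  proof (induction k rule: dec_induct)
    case base
    show ?case using small_trace_next[OF K0 K1(2)] K1(1) by (simp add: K_def)
  next
    case (step k)
    then show ?case using square_around_next[OF nz K0, of k] K1(1) by (simp add: K_def)
  qed
  have sym: "n k = 3" "s k = 1" "c k 1 = \<beta> (Suc k)" "c k (-2) = \<beta> (Suc k)" "\<beta> (Suc k) \<noteq> \<beta> k"
    if "k \<ge> K" for k
    using square_around_next[OF nz K0, of k] around[OF that] that K1(1) by (auto simp: K_def)
  define A where "A = (\<lambda>k. M k (\<beta> k))"
  define B where "B = (\<lambda>k. M k (\<beta> (Suc k)))"
  define C where "C = (\<lambda>k. B k ** A k - A k ** B k)"
  define x where "x = (\<lambda>k. trace (A k))"
  define y where "y = (\<lambda>k. trace (B k))"
  have det: "det (A k) = 1" "det (B k) = 1" "det (A k - B k) = 0" for k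
    by (simp_all add: A_def B_def det_M det_M_diff)
  have A_Suc: "A (Suc k) = A k ** B k ** A k" if "k \<ge> K" for k
    using sym[OF that] by (simp add: A_def B_def M_Suc)
  have B_Suc: "B (Suc k) = A k ** A k ** A k" if "k \<ge> K" for k
  proof -
    \<comment> \<open>With two letters, changing at every level means alternating.\<close>
    have "\<beta> (Suc (Suc k)) = \<beta> k"
      using eq_of_two_elements[OF \<beta>_range \<beta>_range \<beta>_range] sym(5)[of k] sym(5)[of "Suc k"] that
      by (metis le_SucI)
    then show ?thesis using sym[OF that] by (simp add: A_def B_def M_Suc)
  qed
  obtain i where i: "\<omega> $ i \<noteq> 0" using nz by (auto simp: \<omega>_def vec_eq_iff)
  have lim: "(\<lambda>k. \<Omega> k j $ m) \<longlonglongrightarrow> 0" if "j \<noteq> 0" for j m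
    using tendsto_vec_nth[OF \<Omega>_scale_lim[OF that], of m] by simp
  have evK: "eventually (\<lambda>k. k \<ge> K) sequentially" by (rule eventually_ge_at_top)

  have x_eq: "x k = (\<Omega> k 1 $ i + \<Omega> k (-1) $ i) / \<omega> $ i" if "k \<ge> K" for k
  proof -
    have "x k *s \<omega> = \<Omega> k 1 + \<Omega> k (-1)"
      using square_around[of k] around[OF that] by (simp add: x_def A_def \<omega>_def)
    then have "x k * \<omega> $ i = \<Omega> k 1 $ i + \<Omega> k (-1) $ i" by (metis vector_add_component vector_smult_component)
    then show ?thesis using i by (simp add: field_simps)
  qed
  have "(\<lambda>k. (\<Omega> k 1 $ i + \<Omega> k (-1) $ i) / \<omega> $ i) \<longlonglongrightarrow> (0 + 0) / \<omega> $ i"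
    by (intro tendsto_intros lim i) auto
  then have x_lim: "x \<longlonglongrightarrow> 0"
    using tendsto_cong[OF eventually_mono[OF evK x_eq]] by simp
  have "(\<lambda>k. x k ^ 3 - 3 * x k) \<longlonglongrightarrow> 0 ^ 3 - 3 * 0"
    by (intro tendsto_intros x_lim)
  moreover have "y (Suc k) = x k ^ 3 - 3 * x k" if "k \<ge> K" for k
    using trace_cube[OF det(1)[of k]] B_Suc[OF that] by (simp add: x_def y_def)
  ultimately have "(\<lambda>k. y (Suc k)) \<longlonglongrightarrow> 0"
    using tendsto_cong[OF eventually_mono[OF evK, of "\<lambda>k. y (Suc k) = x k ^ 3 - 3 * x k"]] by simp
  then have y_lim: "y \<longlonglongrightarrow> 0" by (simp add: filterlim_sequentially_Suc)

  \<comment> \<open>Blocks -2, ..., 1 have the monodromies B, A, A, B. Thus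
    \<open>B k ** A k\<close> leads from the origin to \<open>\<Omega> k 2\<close>, and
    Cayley-Hamilton for \<open>A k ** B k\<close> is applied to
    \<open>\<Omega> k (-2)\<close>.\<close>
  have C_eq: "(C k *v \<omega>) $ m = \<Omega> k 2 $ m + \<Omega> k (-2) $ m - (x k * y k - 2) * \<omega> $ m"
    if "k \<ge> K" for k m
  proof -
    have 0: "\<Omega> k 0 = \<omega>" by (simp add: \<omega>_def \<Omega>_zero[of k])
    have c: "c k 0 = \<beta> k" "c k (-1) = \<beta> k" "c k 1 = \<beta> (Suc k)" "c k (-2) = \<beta> (Suc k)"
      using around[OF that] sym[OF that] by auto
    have 2: "\<Omega> k 2 = (B k ** A k) *v \<omega>"
      using \<Omega>_rec[of k 0] \<Omega>_rec[of k 1] by (simp add: c 0 A_def B_def matrix_vector_mul_assoc)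
    have m2: "\<omega> = (A k ** B k) *v \<Omega> k (-2)"
      using \<Omega>_rec[of k "-1"] \<Omega>_rec[of k "-2"] by (simp add: c 0 A_def B_def matrix_vector_mul_assoc)
    have "(A k ** B k) *v \<omega> + \<Omega> k (-2) = (x k * y k - 2) *s \<omega>"
      using cayley_hamilton2[of "A k ** B k" "\<Omega> k (-2)"] trace_mult_rank_one[OF det]
      by (simp add: det_mul det x_def y_def flip: m2)
    then have "((A k ** B k) *v \<omega>) $ m + \<Omega> k (-2) $ m = (x k * y k - 2) * \<omega> $ m"
      by (metis vector_add_component vector_smult_component)
    then show ?thesis by (simp add: C_def matrix_vector_mult_diff_rdistrib 2 algebra_simps)
  qed
  have C_lim: "(\<lambda>k. (C k *v \<omega>) $ m) \<longlonglongrightarrow> 2 * \<omega> $ m" for m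
  proof -
    have "(\<lambda>k. \<Omega> k 2 $ m + \<Omega> k (-2) $ m - (x k * y k - 2) * \<omega> $ m) \<longlonglongrightarrow> 0 + 0 - (0 * 0 - 2) * \<omega> $ m"
      by (intro tendsto_intros lim x_lim y_lim) auto
    then show ?thesis
      using tendsto_cong[OF eventually_mono[OF evK C_eq[of _ m]]] by simp
  qed

  \<comment> \<open>By \<open>commutator_conj\<close> each level contributes one factor, so all
    later commutators are multiples of \<open>C K\<close>.\<close>
  define \<mu> where "\<mu> = (\<lambda>j. \<Prod>i<j. 1 - (x (K + i))\<^sup>2)"
  have C_mult: "C (K + j) *v w = \<mu> j *s (C K *v w)" for j w
  proof (induction j)
    case (Suc j)
    have "C (Suc (K + j)) *v w = (1 - (x (K + j))\<^sup>2) *s (C (K + j) *v w)"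
      unfolding C_def using commutator_conj[OF det(1), of "K + j" "B (K + j)" w]
      by (simp add: A_Suc B_Suc x_def)
    then show ?case using Suc by (simp add: \<mu>_def vector_smult_assoc mult.commute)
  qed (simp add: \<mu>_def)
  define v where "v = C K *v \<omega>"
  define d where "d = (x K - y K)\<^sup>2"
  have Cv: "C K *v v = d *s \<omega>"
    unfolding v_def d_def C_def x_def y_def by (rule commutator_sq[OF det])
  have l1: "(\<lambda>j. \<mu> j * v $ m) \<longlonglongrightarrow> 2 * \<omega> $ m" for m
    using LIMSEQ_ignore_initial_segment[OF C_lim[of m], of K]
    by (simp add: add.commute[of _ K] C_mult v_def)
  \<comment> \<open>Apply the fixed matrix \<open>C K\<close>, whose square is the scalar
    \<open>d\<close>, to \<open>l1\<close>.\<close>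
  have l2: "(\<lambda>j. \<mu> j * (d * \<omega> $ i)) \<longlonglongrightarrow> 2 * v $ i"
  proof -
    have "(\<lambda>j. \<mu> j *s v) \<longlonglongrightarrow> 2 *s \<omega>"
      by (rule vec_tendstoI) (simp add: l1)
    then have "(\<lambda>j. C K *v (\<mu> j *s v)) \<longlonglongrightarrow> C K *v (2 *s \<omega>)"
      by (rule tendsto_matrix_vector)
    moreover have "C K *v (\<mu> j *s v) = (\<mu> j * d) *s \<omega>" for j
      by (simp only: vector_scalar_commute Cv vector_smult_assoc)
    moreover have "C K *v (2 *s \<omega>) = 2 *s v"
      by (simp only: vector_scalar_commute v_def)
    ultimately have "(\<lambda>j. (\<mu> j * d) *s \<omega>) \<longlonglongrightarrow> 2 *s v" by simp
    from tendsto_vec_nth[OF this, of i] show ?thesis by (simp add: mult_ac)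
  qed
  \<comment> \<open>The square of the commutator on level K + j is the squared difference of the
    traces there.\<close>
  have l3: "(\<lambda>j. (\<mu> j)\<^sup>2 * d) \<longlonglongrightarrow> 0"
  proof -
    have "(\<mu> j)\<^sup>2 * d * \<omega> $ i = (x (K + j) - y (K + j))\<^sup>2 * \<omega> $ i" for j
    proof -
      have "(x (K + j) - y (K + j))\<^sup>2 *s \<omega> = C (K + j) *v (C (K + j) *v \<omega>)"
        unfolding C_def x_def y_def by (rule commutator_sq[OF det, symmetric])
      also have "\<dots> = \<mu> j *s (\<mu> j *s (d *s \<omega>))"
        by (simp only: C_mult vector_scalar_commute v_def[symmetric] Cv)
      finally have "(x (K + j) - y (K + j))\<^sup>2 * \<omega> $ i = \<mu> j * (\<mu> j * (d * \<omega> $ i))"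
        by (metis vector_smult_component)
      then show ?thesis by (simp only: power2_eq_square mult_ac)
    qed
    then have "(\<mu> j)\<^sup>2 * d = (x (j + K) - y (j + K))\<^sup>2" for j
      using i unfolding add.commute[of j K] mult_right_cancel[OF i] by blast
    moreover have "(\<lambda>j. (x (j + K) - y (j + K))\<^sup>2) \<longlonglongrightarrow> (0 - 0)\<^sup>2"
      by (intro tendsto_intros LIMSEQ_ignore_initial_segment x_lim y_lim)
    ultimately show ?thesis by simp
  qed
  have "v $ i \<noteq> 0"
  proof
    assume "v $ i = 0"
    then show False using l1[of i] i by (simp add: LIMSEQ_const_iff)
  qed
  \<comment> \<open>The product of \<open>l1\<close> and \<open>l2\<close> has a nonzero limit, but
    by \<open>l3\<close> it tends to 0.\<close>
  have "(\<lambda>j. (\<mu> j * v $ i) * (\<mu> j * (d * \<omega> $ i))) \<longlonglongrightarrow> (2 * \<omega> $ i) * (2 * v $ i)"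
    by (intro tendsto_mult l1 l2)
  moreover have "(\<lambda>j. (\<mu> j * v $ i) * (\<mu> j * (d * \<omega> $ i))) \<longlonglongrightarrow> 0 * (v $ i * \<omega> $ i)"
    using tendsto_mult[OF l3 tendsto_const[of "v $ i * \<omega> $ i"]]
    by (simp add: power2_eq_square mult_ac)
  ultimately have "(2 * \<omega> $ i) * (2 * v $ i) = 0 * (v $ i * \<omega> $ i)" by (rule LIMSEQ_unique)
  then show False using i \<open>v $ i \<noteq> 0\<close> by simp
qed
end

subsection \<open>Hole structure of simple Toeplitz subshifts\<close>

definition period :: "(nat \<Rightarrow> nat) \<Rightarrow> nat \<Rightarrow> nat" where
  "period n k = (\<Prod>j<k. n j)"

lemma period_simps [simp]: "period n 0 = 1" "period n (Suc k) = period n k * n k"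
  by (simp_all add: period_def)

lemma period_dvd: "j \<le> k \<Longrightarrow> period n j dvd period n k"
  unfolding period_def by (rule prod_dvd_prod_subset) auto

lemma nth_concat_replicate:
  "i < m * length w \<Longrightarrow> concat (replicate m w) ! i = w ! (i mod length w)"
proof (induction m arbitrary: i)
  case (Suc m)
  show ?case
  proof (cases "i < length w")
    case False
    then show ?thesis using Suc.prems Suc.IH[of "i - length w"]
      by (simp add: nth_append le_mod_geq)
  qed (simp add: nth_append)
qed simp

context
  fixes b :: "nat \<Rightarrow> 'a" and n :: "nat \<Rightarrow> nat"
  assumes n_ge: "\<And>k. 2 \<le> n k"
begin

lemma period_pos: "0 < period n k"
  unfolding period_def using n_ge by (intro prod_pos) (metis less_le_trans pos2)

lemma strict_mono_period: "strict_mono (period n)"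
proof (rule strict_monoI_Suc)
  fix k
  have "period n k * 1 < period n k * n k"
    using period_pos[of k] n_ge[of k] by (intro mult_strict_left_mono) auto
  then show "period n k < period n (Suc k)" by simp
qed

lemma less_period: "k < period n k"
proof (induction k)
  case (Suc k)
  then show ?case using strict_mono_period[THEN strict_monoD, of k "Suc k"] by linarith
qed simp

lemma length_toep_word: "length (toep_word b n k) = period n k"
proof (induction k)
  case (Suc k)
  have "0 < n k * period n k" using period_pos[of "Suc k"] by (simp add: mult.commute)
  then show ?case using Suc by (simp add: length_concat sum_list_replicate mult.commute)
qed simp

text \<open>Each step rewrites the last letter of the word, so positions count from 1, as
  \<open>Suc i\<close>. Copying a word of level k preserves divisibility by the periods up to that
  level.\<close>

lemma toep_word_nth:
  assumes "j \<le> k" "period n j dvd Suc i" "j < k \<Longrightarrow> \<not> period n (Suc j) dvd Suc i" "i < period n k"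
  shows "toep_word b n k ! i = b j"
  using assms
proof (induction k arbitrary: i)
  case (Suc k)
  let ?w = "concat (replicate (n k) (toep_word b n k))"
  have len: "length ?w = period n (Suc k)"
    by (simp add: length_concat sum_list_replicate length_toep_word mult.commute)
  show ?case
  proof (cases "j = Suc k")
    case True
    then have "Suc i = period n (Suc k)" using Suc.prems(2,4) by (metis Suc_leI dvd_imp_le le_antisym zero_less_Suc)
    then have "i = length (butlast ?w)" using len by simp
    then show ?thesis using True by (simp only: toep_word.simps nth_append_length)
  next
    case False
    then have jk: "j \<le> k" using Suc.prems(1) by simp
    have "Suc i \<noteq> period n (Suc k)"
      using Suc.prems(3) jk period_dvd[of "Suc j" "Suc k" n] by auto
    then have i: "i < length (butlast ?w)" using Suc.prems(4) len by simp
    then have "toep_word b n (Suc k) ! i = ?w ! i"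
      by (simp add: nth_append nth_butlast)
    also have "\<dots> = toep_word b n k ! (i mod period n k)"
      using Suc.prems(4) by (simp add: nth_concat_replicate length_toep_word mult.commute)
    also have "\<dots> = b j"
    proof (rule Suc.IH[OF jk])
      have dvd: "q dvd Suc (i mod period n k) \<longleftrightarrow> q dvd Suc i" if "q dvd period n k" for q
      proof -
        have "Suc i = period n k * (i div period n k) + Suc (i mod period n k)" by simp
        then show ?thesis using that by (metis dvd_add_right_iff dvd_mult2)
      qed
      show "period n j dvd Suc (i mod period n k)"
        using dvd[OF period_dvd[OF jk]] Suc.prems(2) by simp
      show "\<not> period n (Suc j) dvd Suc (i mod period n k)" if "j < k"
        using dvd[OF period_dvd, of "Suc j"] Suc.prems(3) that by simp
      show "i mod period n k < period n k" using period_pos by simp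
    qed
    finally show ?thesis .
  qed
qed simp

lemma toep_seq_nth:
  assumes "period n j dvd Suc i" "\<not> period n (Suc j) dvd Suc i"
  shows "toep_seq b n i = b j"
proof -
  define k where "k = (LEAST k. i < length (toep_word b n k))"
  have "i < length (toep_word b n i)" by (simp add: length_toep_word less_period)
  then have k: "i < period n k" unfolding k_def length_toep_word[symmetric] by (rule LeastI)
  have "period n j \<le> period n k" using dvd_imp_le[OF assms(1)] k by simp
  then have "j \<le> k" using strict_mono_less_eq[OF strict_mono_period] by simp
  then show ?thesis unfolding toep_seq_def k_def[symmetric] using assms k by (intro toep_word_nth)
qed

lemma exact_level:
  fixes i :: nat
  obtains j where "period n j dvd Suc i" "\<not> period n (Suc j) dvd Suc i"
proof -
  define k where "k = (LEAST k. \<not> period n k dvd Suc i)"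
  have "\<not> period n (Suc i) dvd Suc i"
    using less_period[of "Suc i"] by (auto dest: dvd_imp_le)
  then have k: "\<not> period n k dvd Suc i" unfolding k_def by (rule LeastI)
  then obtain j where j: "k = Suc j" by (cases k) auto
  have "period n j dvd Suc i" using not_less_Least[of j "\<lambda>k. \<not> period n k dvd Suc i"] j by (simp add: k_def)
  then show ?thesis using that k j by blast
qed

lemma toep_seq_range: "toep_seq b n i \<in> range b"
  using exact_level[of i] toep_seq_nth by (metis rangeI)

lemma toep_subshift_range:
  assumes "x \<in> toep_subshift b n"
  shows "x m \<in> range b"
proof -
  obtain i where "\<forall>t\<le>nat (m - m). x (m + int t) = toep_seq b n (i + t)"
    using assms unfolding toep_subshift_def by blast
  then show ?thesis using toep_seq_range by auto
qed

text \<open>The positions congruent to \<open>r k\<close> are the holes of level \<open>k\<close>; at most one position is a hole of every level,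
  and there \<open>skeleton\<close> leaves \<open>x\<close> free.\<close>
definition skeleton :: "(int \<Rightarrow> 'a) \<Rightarrow> (nat \<Rightarrow> int) \<Rightarrow> bool" where
  "skeleton x r \<longleftrightarrow> (\<forall>k. int (period n k) dvd r (Suc k) - r k) \<and>
     (\<forall>k m. int (period n k) dvd m - r k \<longrightarrow> \<not> int (period n (Suc k)) dvd m - r (Suc k) \<longrightarrow> x m = b k)"

text \<open>A compactness argument: each window of x occurs in the one-sided sequence with its own
  hole positions, and the pigeonhole principle selects, level by level, a residue shared by
  infinitely many windows.\<close>

lemma toep_subshift_skeleton:
  assumes "x \<in> toep_subshift b n"
  obtains r where "skeleton x r"
proof -
  have "\<exists>i. \<forall>t. t \<le> 2 * N \<longrightarrow> x (- int N + int t) = toep_seq b n (i + t)" for N :: nat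
  proof -
    have "\<exists>i. \<forall>t. t \<le> nat (int N - - int N) \<longrightarrow> x (- int N + int t) = toep_seq b n (i + t)"
      by (rule assms[unfolded toep_subshift_def mem_Collect_eq, THEN spec, THEN spec, THEN mp]) simp
    moreover have "nat (int N - - int N) = 2 * N" by simp
    ultimately show ?thesis by simp
  qed
  then obtain \<iota> where \<iota>: "\<And>N t. t \<le> 2 * N \<Longrightarrow> x (- int N + int t) = toep_seq b n (\<iota> N + t)" by metis
  \<comment> \<open>Then position \<open>m = int t - int N\<close> has
    \<open>m - \<rho> N = int (Suc (\<iota> N + t))\<close>.\<close>
  define \<rho> where "\<rho> = (\<lambda>N. - int (\<iota> N + N + 1))"
  have local_level: "x m = b j"
    if "int (period n j) dvd m - \<rho> N" "\<not> int (period n (Suc j)) dvd m - \<rho> N" "\<bar>m\<bar> \<le> int N" for m j N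
  proof -
    define t where "t = nat (m + int N)"
    have t: "int t = m + int N" "t \<le> 2 * N" using that(3) by (auto simp: t_def)
    have "m - \<rho> N = int (Suc (\<iota> N + t))" using t by (simp add: \<rho>_def)
    then have "toep_seq b n (\<iota> N + t) = b j" using that(1,2) by (intro toep_seq_nth) (simp_all only: int_dvd_int_iff not_False_eq_True)
    then show ?thesis using \<iota>[OF t(2)] t(1) by simp
  qed
  define P where "P = (\<lambda>k r. infinite {N. int (period n k) dvd \<rho> N - r})"
  obtain r where r: "\<And>k. P k (r k)" "\<And>k. int (period n k) dvd r (Suc k) - r k"
  proof -
    have "\<exists>r. \<forall>k. P k (r k) \<and> int (period n k) dvd r (Suc k) - r k"
    proof (rule dependent_nat_choice)
      show "\<exists>r. P 0 r" by (simp add: P_def)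
      fix r k assume "P k r"
      define S where "S = {N. int (period n k) dvd \<rho> N - r}"
      let ?f = "\<lambda>N. \<rho> N mod int (period n (Suc k))"
      have "?f ` S \<subseteq> {0..<int (period n (Suc k))}"
        using period_pos[of "Suc k"] by (auto simp del: period_simps)
      then have "finite (?f ` S)" by (rule finite_subset) simp
      then obtain M where M: "M \<in> S" "infinite {N \<in> S. ?f N = ?f M}"
        using pigeonhole_infinite[of S ?f] \<open>P k r\<close> unfolding P_def S_def by blast
      have "{N \<in> S. ?f N = ?f M} \<subseteq> {N. int (period n (Suc k)) dvd \<rho> N - \<rho> M}"
        by (auto simp: mod_eq_dvd_iff simp del: period_simps)
      then have "P (Suc k) (\<rho> M)" using M(2) unfolding P_def by (meson infinite_super)
      then show "\<exists>r'. P (Suc k) r' \<and> int (period n k) dvd r' - r"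
        using M(1) unfolding S_def by blast
    qed
    then show ?thesis using that by blast
  qed
  have "x m = b k"
    if m: "int (period n k) dvd m - r k" "\<not> int (period n (Suc k)) dvd m - r (Suc k)" for k m
  proof -
    have "\<exists>N\<ge>nat \<bar>m\<bar>. int (period n (Suc k)) dvd \<rho> N - r (Suc k)"
      using r(1)[of "Suc k"] unfolding P_def infinite_nat_iff_unbounded_le by blast
    then obtain N where N: "\<bar>m\<bar> \<le> int N" "int (period n (Suc k)) dvd \<rho> N - r (Suc k)"
      by (auto simp: nat_le_iff simp del: period_simps)
    show ?thesis
    proof (rule local_level[OF _ _ N(1)])
      have "int (period n k) dvd \<rho> N - r (Suc k)" using N(2) by (auto dest: dvd_mult_left)
      then have "int (period n k) dvd (m - r k) - (r (Suc k) - r k) - (\<rho> N - r (Suc k))"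
        by (rule dvd_diff[OF dvd_diff[OF m(1) r(2)[of k]]])
      then show "int (period n k) dvd m - \<rho> N" by simp
      show "\<not> int (period n (Suc k)) dvd m - \<rho> N"
      proof
        assume "int (period n (Suc k)) dvd m - \<rho> N"
        from dvd_add[OF this N(2)] show False using m(2) by simp
      qed
    qed
  qed
  with r(2) show ?thesis using that unfolding skeleton_def by blast
qed

lemma skeleton_level:
  assumes "skeleton x r" "\<not> int (period n k) dvd m - r k"
  obtains j where "j < k" "int (period n j) dvd m - r j" "\<not> int (period n (Suc j)) dvd m - r (Suc j)"
proof -
  define i where "i = (LEAST k. \<not> int (period n k) dvd m - r k)"
  have i: "\<not> int (period n i) dvd m - r i" "i \<le> k"
    unfolding i_def using assms(2) by (rule LeastI, intro Least_le)
  then obtain j where j: "i = Suc j" by (cases i) auto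
  have "int (period n j) dvd m - r j"
    using not_less_Least[of j "\<lambda>k. \<not> int (period n k) dvd m - r k"] j by (simp add: i_def)
  then show ?thesis using that[of j] i j by simp
qed

text \<open>Off the holes of level k, a level below k decides the letter, and the position modulo
  \<open>period n k\<close> determines that level.\<close>

lemma skeleton_periodic:
  assumes "skeleton x r" "\<not> int (period n k) dvd m - r k" "int (period n k) dvd q"
  shows "x (m + q) = x m"
proof -
  obtain j where j: "j < k" "int (period n j) dvd m - r j" "\<not> int (period n (Suc j)) dvd m - r (Suc j)"
    by (rule skeleton_level[OF assms(1,2)])
  have q: "int (period n j) dvd q" "int (period n (Suc j)) dvd q"
    using period_dvd[of j k n] period_dvd[of "Suc j" k n] j(1) assms(3)
    by (meson dvd_trans int_dvd_int_iff less_imp_le Suc_leI)+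
  have "x m = b j" using assms(1) j unfolding skeleton_def by blast
  moreover have "int (period n j) dvd (m + q) - r j" "\<not> int (period n (Suc j)) dvd (m + q) - r (Suc j)"
    using dvd_add_left_iff[OF q(1), of "m - r j"] dvd_add_left_iff[OF q(2), of "m - r (Suc j)"] j(2,3)
    by (simp_all add: algebra_simps)
  then have "x (m + q) = b j" using assms(1) unfolding skeleton_def by blast
  ultimately show ?thesis by simp
qed

end

section \<open>Cyclic factors and periods\<close>

lemma lshift_funpow: "(lshift ^^ j) x = (\<lambda>m. x (m + int j))"
  by (induction j) (simp_all add: lshift_def add_ac)

lemma lshift_toep_subshift:
  assumes "x \<in> toep_subshift b n"
  shows "lshift x \<in> toep_subshift b n"
  unfolding toep_subshift_def lshift_def mem_Collect_eq
proof (intro allI impI)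
  fix j k :: int assume "j \<le> k"
  then have "\<exists>i. \<forall>t::nat. t \<le> nat (k + 1 - (j + 1)) \<longrightarrow> x (j + 1 + int t) = toep_seq b n (i + t)"
    by (intro assms[unfolded toep_subshift_def mem_Collect_eq, THEN spec, THEN spec, THEN mp]) simp
  then show "\<exists>i. \<forall>t::nat. t \<le> nat (k - j) \<longrightarrow> x (j + int t + 1) = toep_seq b n (i + t)"
    by (simp add: algebra_simps)
qed

lemma lshift_funpow_toep_subshift:
  "x \<in> toep_subshift b n \<Longrightarrow> (lshift ^^ j) x \<in> toep_subshift b n"
  by (induction j) (simp_all add: lshift_toep_subshift)

lemma tendsto_fun_pointwise:
  fixes f :: "nat \<Rightarrow> 'i \<Rightarrow> 'b::topological_space"
  assumes "\<And>m. (\<lambda>i. f i m) \<longlonglongrightarrow> l m"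
  shows "f \<longlonglongrightarrow> l"
proof -
  have "limitin (product_topology (\<lambda>_. euclidean) UNIV) f l sequentially"
    unfolding limitin_componentwise using assms by auto
  then show ?thesis by (simp add: euclidean_product_topology)
qed

lemma infinitely_often_both_letters:
  fixes b :: "nat \<Rightarrow> 'a"
  assumes "\<forall>k. b k \<in> {a, c}" "\<not> (\<exists>K d. \<forall>k\<ge>K. b k = d)" "d \<in> range b"
  shows "infinite {k. b k = d}"
proof
  assume "finite {k. b k = d}"
  then obtain K where "{k. b k = d} \<subseteq> {..<K}" unfolding finite_nat_iff_bounded ..
  then have K: "b k \<noteq> d" if "k \<ge> K" for k using that by auto
  have letters: "b k = a \<or> b k = c" for k using assms(1) by simp
  obtain l where "d = b l" using assms(3) by blast
  then have "d = a \<or> d = c" using letters by simp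
  then have "\<exists>e. \<forall>k\<ge>K. b k = e" using K letters by blast
  then show False using assms(2) by blast
qed

text \<open>The shifts of \<open>x\<close> by \<open>period n k\<close>, with \<open>k\<close> ranging over the levels whose letter agrees with
  the letter of \<open>x\<close> at the (at most one) position outside the skeleton, converge to \<open>x\<close>.\<close>
lemma Zp_factor_period:
  fixes b :: "nat \<Rightarrow> real"
  assumes n_ge: "\<And>k. 2 \<le> n k" and bin: "\<forall>k. b k \<in> {a, c}" and nconst: "\<not> (\<exists>K d. \<forall>k\<ge>K. b k = d)"
    and fac: "has_Zp_factor (toep_subshift b n) p" and x: "x \<in> toep_subshift b n"
  obtains k where "p dvd period n k"
proof -
  obtain r where r: "skeleton b n x r" using toep_subshift_skeleton[OF n_ge x] .
  \<comment> \<open>Without a position that is a hole of every level, any letter of the coding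
    sequence serves; \<open>b 0\<close> is a default.\<close>
  define d where "d = (if \<exists>h. \<forall>k. int (period n k) dvd h - r k
    then x (SOME h. \<forall>k. int (period n k) dvd h - r k) else b 0)"
  have "d \<in> range b" using toep_subshift_range[OF n_ge x] by (simp add: d_def)
  from infinite_enumerate[OF infinitely_often_both_letters[OF bin nconst this]]
  obtain f :: "nat \<Rightarrow> nat" where f: "strict_mono f" "\<And>i. b (f i) = d" by auto
  define y where "y = (\<lambda>i. (lshift ^^ period n (f i)) x)"
  have "\<exists>I. \<forall>i\<ge>I. y i m = x m" for m
  proof (cases "\<forall>k. int (period n k) dvd m - r k")
    case hole: True
    define h where "h = (SOME h. \<forall>k. int (period n k) dvd h - r k)"
    have h: "int (period n k) dvd h - r k" for k
      unfolding h_def using someI[of "\<lambda>h. \<forall>k. int (period n k) dvd h - r k" m] hole by blast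
    have "int (period n k) dvd m - h" for k
      using dvd_diff[OF hole[rule_format, of k] h[of k]] by simp
    moreover have "nat \<bar>m - h\<bar> < period n (nat \<bar>m - h\<bar>)" by (rule less_period[of n, OF n_ge])
    ultimately have "m = h"
      using zdvd_imp_le[of "int (period n (nat \<bar>m - h\<bar>))" "\<bar>m - h\<bar>"] by (cases "m = h") auto
    then have "x m = d" using hole by (auto simp: d_def h_def)
    moreover have "y i m = d" for i
    proof -
      let ?P = "int (period n (f i))" and ?P' = "int (period n (Suc (f i)))"
      have "?P dvd m + ?P - r (f i)"
        using dvd_add[OF hole[rule_format, of "f i"] dvd_refl[of ?P]] by (simp add: algebra_simps)
      \<comment> \<open>A shift by exactly one period of level \<open>f i\<close> leaves the holes
        of the next level, so the letter found is \<open>b (f i)\<close>.\<close>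
      moreover have "\<not> ?P' dvd m + ?P - r (Suc (f i))"
      proof
        assume "?P' dvd m + ?P - r (Suc (f i))"
        from dvd_diff[OF this hole[rule_format, of "Suc (f i)"]] have "?P' dvd ?P" by (simp add: algebra_simps)
        then have "period n (Suc (f i)) \<le> period n (f i)"
          using period_pos[of n, OF n_ge, of "f i"] by (intro dvd_imp_le) (simp_all only: int_dvd_int_iff)
        then show False using strict_mono_period[of n, OF n_ge, THEN strict_monoD, of "f i" "Suc (f i)"] by simp
      qed
      ultimately have "x (m + ?P) = b (f i)" using r unfolding skeleton_def[OF n_ge] by blast
      then show ?thesis by (simp add: y_def lshift_funpow f)
    qed
    ultimately show ?thesis by auto
  next
    case False
    then obtain k where k: "\<not> int (period n k) dvd m - r k" by blast
    have "y i m = x m" if "i \<ge> k" for i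
    proof -
      have "k \<le> f i" using that seq_suble[OF f(1), of i] by simp
      then have "x (m + int (period n (f i))) = x m"
        using period_dvd[of k "f i" n] by (intro skeleton_periodic[OF n_ge r k]) (simp only: int_dvd_int_iff)
      then show ?thesis by (simp add: y_def lshift_funpow)
    qed
    then show ?thesis by blast
  qed
  then have "(\<lambda>i. y i m) \<longlonglongrightarrow> x m" for m
    by (intro tendsto_eventually) (simp add: eventually_sequentially)
  then have lim: "y \<longlonglongrightarrow> x" by (rule tendsto_fun_pointwise)
  obtain \<pi> :: "(int \<Rightarrow> real) \<Rightarrow> int" where \<pi>: "continuous_on (toep_subshift b n) \<pi>"
    "\<pi> ` toep_subshift b n = {0..<int p}"
    "\<And>x. x \<in> toep_subshift b n \<Longrightarrow> \<pi> (lshift x) = (\<pi> x + 1) mod int p"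
    using fac unfolding has_Zp_factor_def by blast
  have iter: "\<pi> ((lshift ^^ j) x) = (\<pi> x + int j) mod int p" for j
  proof (induction j)
    case 0
    have "\<pi> x \<in> {0..<int p}" using \<pi>(2) x by blast
    then show ?case by simp
  next
    case (Suc j)
    then show ?case using \<pi>(3)[OF lshift_funpow_toep_subshift[OF x, of j]]
      by (simp add: mod_simps add_ac)
  qed
  have "(\<lambda>i. \<pi> (y i)) \<longlonglongrightarrow> \<pi> x"
    using lim x by (intro continuous_on_tendsto_compose[OF \<pi>(1)])
      (auto simp: y_def lshift_funpow_toep_subshift)
  then have "\<forall>\<^sub>F i in sequentially. \<pi> (y i) = \<pi> x" by (simp add: tendsto_discrete)
  then obtain i where "\<pi> (y i) = \<pi> x" by (auto simp: eventually_sequentially)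
  then have "(\<pi> x + int (period n (f i))) mod int p = (\<pi> x) mod int p"
    using iter[of "period n (f i)"] iter[of 0] by (simp add: y_def)
  then have "int p dvd int (period n (f i))" by (simp add: mod_eq_dvd_iff)
  then show ?thesis using that by simp
qed

section \<open>Eigenfunctions and their transfer matrices\<close>

lemma summable_on_imp_vanishing:
  fixes f :: "'a \<Rightarrow> real"
  assumes "f summable_on UNIV"
  shows "(f \<longlongrightarrow> 0) cofinite"
proof (rule tendstoI, rule ccontr)
  fix e :: real assume e: "e > 0" "\<not> eventually (\<lambda>m. dist (f m) 0 < e) cofinite"
  then have "infinite {m. e \<le> \<bar>f m\<bar>}" by (simp add: eventually_cofinite not_less)
  then obtain h :: "nat \<Rightarrow> 'a" where h: "inj h" "\<And>i. e \<le> \<bar>f (h i)\<bar>"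
    using infinite_countable_subset by (metis (mono_tags, lifting) mem_Collect_eq range_subsetD)
  have "f summable_on range h" using assms by (rule summable_on_subset_banach) simp
  then have "summable (f \<circ> h)" using summable_on_reindex[OF h(1)] summable_on_imp_summable by blast
  then have "(\<lambda>i. \<bar>f (h i)\<bar>) \<longlonglongrightarrow> 0" using tendsto_rabs_zero[OF summable_LIMSEQ_zero] by (simp add: o_def)
  then have "e \<le> 0" using h(2) by (intro LIMSEQ_le_const) auto
  then show False using e by simp
qed

primrec transfer :: "(int \<Rightarrow> complex) \<Rightarrow> int \<Rightarrow> nat \<Rightarrow> complex^2^2" where
  "transfer v m 0 = mat 1"
| "transfer v m (Suc j) = step (v (m + int j)) ** transfer v m j"

lemma det_transfer: "det (transfer v m j) = 1"
  by (induction j) (simp_all add: det_mul det_step)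

lemma transfer_cong:
  "(\<And>i. i < j \<Longrightarrow> v (m + int i) = v' (m' + int i)) \<Longrightarrow> transfer v m j = transfer v' m' j"
  by (induction j) simp_all

definition state :: "(int \<Rightarrow> complex) \<Rightarrow> int \<Rightarrow> complex^2" where
  "state \<psi> m = vector [\<psi> m, \<psi> (m - 1)]"

lemma state_transfer:
  assumes "\<And>m. \<psi> (m + 1) + \<psi> (m - 1) = v m * \<psi> m"
  shows "state \<psi> (m + int j) = transfer v m j *v state \<psi> m"
proof (induction j)
  case (Suc j)
  have "state \<psi> (m' + 1) = step (v m') *v state \<psi> m'" for m'
    using assms[of m'] by (simp add: vec2_eq_iff matrix2_vector_nth state_def algebra_simps)
  from this[of "m + int j"] show ?case using Suc by (simp add: matrix_vector_mul_assoc add_ac)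
qed simp

lemma state_zero:
  assumes "\<And>m. \<psi> (m + 1) + \<psi> (m - 1) = v m * \<psi> m" "state \<psi> 0 = 0"
  shows "\<psi> m = 0"
proof -
  have "\<psi> m = 0 \<and> \<psi> (m - 1) = 0"
  proof (induction m rule: int_induct[where k = 0])
    case base
    show ?case using assms(2) by (simp add: state_def vec2_eq_iff)
  next
    case (step1 i)
    then show ?case using assms(1)[of i] by simp
  next
    case (step2 i)
    then show ?case using assms(1)[of "i - 1"] by simp
  qed
  then show ?thesis by simp
qed

lemma periodic_dvd:
  fixes f :: "int \<Rightarrow> 'a"
  assumes "\<forall>m. f (m + q) = f m" "q dvd m - m'"
  shows "f m = f m'"
proof -
  obtain i where i: "m = m' + q * i" using assms(2) by (metis dvdE diff_add_cancel add.commute)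
  have "f (m' + q * i) = f m'"
  proof (induction i rule: int_induct[where k = 0])
    case (step1 i)
    then show ?case using assms(1)[rule_format, of "m' + q * i"] by (simp add: algebra_simps)
  next
    case (step2 i)
    then show ?case using assms(1)[rule_format, of "m' + q * (i - 1)"] by (simp add: algebra_simps)
  qed simp
  then show ?thesis using i by simp
qed

theorem theorem1p3:
  fixes a c :: real and b :: "nat \<Rightarrow> real" and n :: "nat \<Rightarrow> nat"
    and g :: "real \<Rightarrow> real" and n0 :: int and Vper :: "int \<Rightarrow> real" and p :: nat
  assumes "a \<noteq> c"
    and "\<forall>k. b k \<in> {a, c}"
    and "\<forall>k. n k \<ge> 2"
    and "\<not> (\<exists>K d. \<forall>k\<ge>K. b k = d)"
    and "p > 0"
    and "\<forall>m. Vper (m + int p) = Vper m"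
    and "has_Zp_factor (toep_subshift b n) p"
  shows "\<forall>x\<in>toep_subshift b n. \<forall>E.
           \<not> is_eigenvalue (\<lambda>m. g (x (n0 + m)) + Vper m) E"
proof (intro ballI allI notI)
  fix x E
  assume x: "x \<in> toep_subshift b n" and "is_eigenvalue (\<lambda>m. g (x (n0 + m)) + Vper m) E"
  then obtain \<psi> where \<psi>: "(\<lambda>m. (norm (\<psi> m))\<^sup>2) summable_on UNIV" "\<psi> \<noteq> (\<lambda>_. 0)"
      "\<And>m. \<psi> (m + 1) + \<psi> (m - 1) + of_real (g (x (n0 + m)) + Vper m) * \<psi> m = E * \<psi> m"
    unfolding is_eigenvalue_def by blast
  have n_ge: "2 \<le> n k" for k using assms(3) by simp
  obtain r where r: "skeleton b n x r" using toep_subshift_skeleton[OF n_ge x] .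
  obtain k0 where k0: "p dvd period n k0"
    by (rule Zp_factor_period[OF n_ge assms(2,4,7) x])
  define v where "v m = E - of_real (g (x (n0 + m)) + Vper m)" for m
  have eq: "\<psi> (m + 1) + \<psi> (m - 1) = v m * \<psi> m" for m
    using \<psi>(3)[of m] by (simp add: v_def algebra_simps)
  \<comment> \<open>Level j of the cocycle is level k0 + j of the skeleton, so p divides every
    period in use.\<close>
  define P where "P j = int (period n (k0 + j))" for j
  \<comment> \<open>The offset of the hole in a block, in coordinates shifted by \<open>n0\<close>.
    Reducing it modulo \<open>P j\<close> lets block 0 of every level start at the origin.\<close>
  define h where "h j = (r (k0 + j) - n0) mod P j" for j
  define s where "s j = nat (h (Suc j) div P j)" for j
  \<comment> \<open>All holes see the value of \<open>Vper\<close> at \<open>h 0\<close>, because p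
    divides \<open>P 0\<close>.\<close>
  define val where "val d = E - of_real (g d + Vper (h 0))" for d
  have P_pos: "0 < P j" for j using period_pos[of n, OF n_ge] by (simp add: P_def)
  have P_Suc: "P (Suc j) = P j * int (n (k0 + j))" for j by (simp add: P_def)
  have P_dvd: "P 0 dvd P j" for j using period_dvd[of k0 "k0 + j" n] by (simp add: P_def)
  have h_bounds: "0 \<le> h j" "h j < P j" for j using P_pos[of j] by (simp_all add: h_def)
  have h_dvd: "P j dvd r (k0 + j) - n0 - h j" for j by (simp add: h_def mod_eq_dvd_iff[symmetric])
  have h_next: "P j dvd h (Suc j) - h j" for j
  proof -
    have "P j dvd r (k0 + Suc j) - n0 - h (Suc j)"
      using h_dvd[of "Suc j"] P_Suc[of j] by (metis dvd_mult_left)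
    moreover have "P j dvd r (k0 + Suc j) - r (k0 + j)"
      using r unfolding skeleton_def[OF n_ge] P_def by simp
    ultimately have "P j dvd (r (k0 + Suc j) - r (k0 + j)) + (r (k0 + j) - n0 - h j) - (r (k0 + Suc j) - n0 - h (Suc j))"
      using h_dvd[of j] by (intro dvd_diff[OF dvd_add])
    then show ?thesis by simp
  qed
  have h_Suc: "h (Suc j) = h j + int (s j) * P j" for j
  proof -
    have "h (Suc j) mod P j = h j mod P j" using h_next[of j] by (simp add: mod_eq_dvd_iff)
    then have "h (Suc j) mod P j = h j" using h_bounds[of j] by simp
    moreover have "int (s j) = h (Suc j) div P j"
      using h_bounds(1)[of "Suc j"] P_pos[of j] by (simp add: s_def pos_imp_zdiv_nonneg_iff)
    ultimately show ?thesis using mod_mult_div_eq[of "h (Suc j)" "P j"] by (simp add: mult.commute)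
  qed
  have h0_dvd: "P 0 dvd h j - h 0" for j
  proof (induction j)
    case (Suc j)
    from dvd_add[OF Suc dvd_trans[OF P_dvd h_next[of j]]] show ?case by simp
  qed simp
  have Vper: "Vper m = Vper m'" if "P 0 dvd m - m'" for m m'
  proof (rule periodic_dvd[OF assms(6)])
    have "int p dvd P 0" using k0 by (simp add: P_def)
    then show "int p dvd m - m'" using that by (rule dvd_trans)
  qed
  have Vper_h: "Vper (h j + i * P j) = Vper (h 0)" for i j
    using dvd_add[OF h0_dvd[of j] dvd_mult[OF P_dvd[of j], of i]] by (intro Vper) (simp add: algebra_simps)
  have letters: "x m \<in> {a, c}" for m using toep_subshift_range[OF n_ge x, of m] assms(2) by auto
  \<comment> \<open>Off the holes both the letters and \<open>Vper\<close> repeat with period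
    \<open>P 0\<close>, so all blocks share X and Y.\<close>
  have v_periodic: "v (m + i * P 0) = v m" if "\<not> P 0 dvd m - h 0" for m i
  proof -
    have "\<not> int (period n k0) dvd n0 + m - r k0"
    proof
      assume "int (period n k0) dvd n0 + m - r k0"
      then have "P 0 dvd (n0 + m - r k0) + (r (k0 + 0) - n0 - h 0)"
        using h_dvd[of 0] by (intro dvd_add) (simp_all add: P_def)
      then show False using that by simp
    qed
    moreover have "int (period n k0) dvd i * P 0" unfolding P_def add_0_right by (rule dvd_triv_right)
    ultimately have "x (n0 + m + i * P 0) = x (n0 + m)" by (rule skeleton_periodic[OF n_ge r])
    moreover have "Vper (m + i * P 0) = Vper m" by (rule Vper) simp
    ultimately show ?thesis by (simp add: v_def add.assoc)
  qed
  have ev_change: "\<exists>k\<ge>K. b (k0 + k) \<noteq> b (k0 + Suc k)" for K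
  proof (rule ccontr)
    assume neg: "\<not> (\<exists>k\<ge>K. b (k0 + k) \<noteq> b (k0 + Suc k))"
    have "b k = b (k0 + K)" if "k \<ge> k0 + K" for k
      using that
    proof (induction k rule: dec_induct)
      case (step k)
      then show ?case using neg[simplified, rule_format, of "k - k0"] by simp
    qed simp
    then show False using assms(4) by blast
  qed
  define q where "q = nat (P 0)"
  have q: "int q = P 0" using P_pos[of 0] by (simp add: q_def)
  define X where "X = transfer v 0 (nat (h 0))"
  define Y where "Y = transfer v (h 0 + 1) (q - 1 - nat (h 0))"
  interpret toeplitz_cocycle "\<lambda>j i. state \<psi> (i * P j)" "\<lambda>j i. v (h j + i * P j)"
    "\<lambda>j. n (k0 + j)" s "\<lambda>j. val (b (k0 + j))" "val a" "val c" X Y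
  proof
    fix j :: nat and i :: int
    show "2 \<le> n (k0 + j)" by (rule n_ge)
    have "int (s j) * P j < int (n (k0 + j)) * P j"
      using h_Suc[of j] h_bounds(1)[of j] h_bounds(2)[of "Suc j"] P_Suc[of j] by (simp add: mult.commute)
    then show s_less: "s j < n (k0 + j)" using P_pos[of j] by simp
    show "state \<psi> (i * P (Suc j)) = state \<psi> (int (n (k0 + j)) * i * P j)"
      by (simp add: P_Suc mult_ac)
    show "v (h (Suc j) + i * P (Suc j)) = v (h j + (int (s j) + int (n (k0 + j)) * i) * P j)"
      by (simp add: P_Suc h_Suc algebra_simps)
    show "v (h j + i * P j) = val (b (k0 + j))" if "i mod int (n (k0 + j)) \<noteq> int (s j)"
    proof -
      let ?m = "n0 + (h j + i * P j)"
      have "P j dvd i * P j - (r (k0 + j) - n0 - h j)" by (intro dvd_diff h_dvd) simp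
      then have d1: "int (period n (k0 + j)) dvd ?m - r (k0 + j)" by (simp add: P_def algebra_simps)
      have d2: "\<not> int (period n (Suc (k0 + j))) dvd ?m - r (Suc (k0 + j))"
      proof
        assume "int (period n (Suc (k0 + j))) dvd ?m - r (Suc (k0 + j))"
        then have "P (Suc j) dvd (?m - r (Suc (k0 + j))) + (r (k0 + Suc j) - n0 - h (Suc j))"
          using h_dvd[of "Suc j"] by (intro dvd_add) (simp_all only: P_def add_Suc_right)
        then have "P j * int (n (k0 + j)) dvd P j * (i - int (s j))"
          by (simp add: h_Suc P_Suc algebra_simps)
        then have "int (n (k0 + j)) dvd i - int (s j)" using P_pos[of j] by simp
        then have "i mod int (n (k0 + j)) = int (s j) mod int (n (k0 + j))" by (simp add: mod_eq_dvd_iff)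
        then show False using that s_less by simp
      qed
      have "x ?m = b (k0 + j)" using r d1 d2 unfolding skeleton_def[OF n_ge] by blast
      then show ?thesis by (simp add: v_def val_def Vper_h)
    qed
    show "v (h 0 + i * P 0) \<in> {val a, val c}"
      using letters[of "n0 + (h 0 + i * P 0)"] by (auto simp: v_def val_def Vper_h)
    show "val (b (k0 + j)) \<in> {val a, val c}" using assms(2) by auto
    \<comment> \<open>The first alternative occurs when g identifies the two letters.\<close>
    show "val a = val c \<or> (\<forall>K. \<exists>k\<ge>K. val (b (k0 + k)) \<noteq> val (b (k0 + Suc k)))"
    proof (cases "val a = val c")
      case False
      then have val_inj: "val d \<noteq> val e" if "d \<in> {a, c}" "e \<in> {a, c}" "d \<noteq> e" for d e
        using that by auto
      have "\<exists>k\<ge>K. val (b (k0 + k)) \<noteq> val (b (k0 + Suc k))" for K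
      proof -
        obtain k where "k \<ge> K" "b (k0 + k) \<noteq> b (k0 + Suc k)" using ev_change by blast
        then show ?thesis using val_inj[OF assms(2)[rule_format] assms(2)[rule_format]] by blast
      qed
      then show ?thesis by blast
    qed simp
    show "det X = 1" "det Y = 1" by (simp_all add: X_def Y_def det_transfer)
    show "state \<psi> ((i + 1) * P 0) = (Y ** step (v (h 0 + i * P 0)) ** X) *v state \<psi> (i * P 0)"
    proof -
      let ?m = "i * P 0"
      have hq: "int (nat (h 0)) = h 0" "nat (h 0) < q" using h_bounds[of 0] q by auto
      have X: "transfer v ?m (nat (h 0)) = X"
        unfolding X_def
      proof (rule transfer_cong)
        fix l assume l: "l < nat (h 0)"
        have "\<not> P 0 dvd int l - h 0"
          using l h_bounds[of 0] zdvd_not_zless[of "h 0 - int l" "P 0"] by (subst dvd_diff_commute) linarith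
        from v_periodic[OF this, of i] show "v (?m + int l) = v (0 + int l)" by (simp add: add.commute)
      qed
      have Y: "transfer v (?m + h 0 + 1) (q - 1 - nat (h 0)) = Y"
        unfolding Y_def
      proof (rule transfer_cong)
        fix l assume l: "l < q - 1 - nat (h 0)"
        have "\<not> P 0 dvd (h 0 + 1 + int l) - h 0"
          using l h_bounds[of 0] q zdvd_not_zless[of "1 + int l" "P 0"] by (simp add: algebra_simps)
        from v_periodic[OF this, of i] show "v (?m + h 0 + 1 + int l) = v (h 0 + 1 + int l)"
          by (simp add: algebra_simps)
      qed
      have 1: "state \<psi> (?m + h 0) = X *v state \<psi> ?m"
        using state_transfer[of \<psi> v ?m "nat (h 0)", OF eq] X hq by simp
      have 2: "state \<psi> (?m + h 0 + 1) = step (v (h 0 + ?m)) *v state \<psi> (?m + h 0)"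
        using state_transfer[of \<psi> v "?m + h 0" 1, OF eq] by (simp add: add.commute)
      have 3: "state \<psi> (?m + h 0 + 1 + int (q - 1 - nat (h 0))) = Y *v state \<psi> (?m + h 0 + 1)"
        using state_transfer[of \<psi> v "?m + h 0 + 1" "q - 1 - nat (h 0)", OF eq] Y by simp
      have "?m + h 0 + 1 + int (q - 1 - nat (h 0)) = (i + 1) * P 0"
        using hq q by (simp add: of_nat_diff algebra_simps)
      then show ?thesis using 1 2 3 by (simp add: matrix_vector_mul_assoc matrix_mul_assoc)
    qed
    show "((\<lambda>i. state \<psi> (i * P 0)) \<longlongrightarrow> 0) cofinite"
    proof (rule vec_tendstoI)
      fix t :: 2
      have "((\<lambda>m. (norm (\<psi> m))\<^sup>2) \<longlongrightarrow> 0) cofinite" using \<psi>(1) by (rule summable_on_imp_vanishing)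
      from tendsto_real_sqrt[OF this] have lim: "(\<psi> \<longlongrightarrow> 0) cofinite"
        by (simp add: tendsto_norm_zero_iff)
      have "inj (\<lambda>i. i * P 0)" "inj (\<lambda>i. i * P 0 - 1)" using P_pos[of 0] by (auto simp: inj_def)
      note lims = this[THEN filterlim_cofinite_inj, THEN filterlim_compose[OF lim]]
      have "t = 1 \<or> t = 2" by (rule exhaust_2)
      then show "((\<lambda>i. state \<psi> (i * P 0) $ t) \<longlongrightarrow> 0 $ t) cofinite"
        using lims by (auto simp: state_def)
    qed
  qed
  have "state \<psi> 0 = 0" using \<Omega>_vanishes by simp
  then have "\<psi> = (\<lambda>_. 0)" using state_zero[of \<psi> v, OF eq] by blast
  then show False using \<psi>(2) by blast
qed

end
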